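(* Let $k$ be a field, $G$ a finite group, $\omega:G\times G\times G\to k^*$ a normalized $3$-cocycle on $G$ and $\mathfrak g\in G$. Define $\flat_{\mathfrak g}\omega:G\times G\to k^*$ by $$\flat_{\mathfrak g}\omega(x,y)=\frac{\omega(\mathfrak g,x,y)\,\omega(x,y,\mathfrak g)}{\omega(x,\mathfrak g,y)},\qquad x,y\in G.$$ Then $\flat_{\mathfrak g}\omega$ is a normalized $2$-cocycle on $G$ if and only if $$\omega(\mathfrak gx,y,z)\,\omega(x,\mathfrak gy,z)\,\omega(x,y,\mathfrak gz)=\omega(x\mathfrak g,y,z)\,\omega(x,y\mathfrak g,z)\,\omega(x,y,z\mathfrak g)\qquad\text{for all }x,y,z\in G.$$ Consequently, $\flat_{\mathfrak g}\omega$ is a normalized $2$-cocycle on $G$, provided that $\mathfrak g$ is in the center of $G$.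
   Context: A normalized $3$-cocycle on $G$ is a map $\omega:G^3\to k^*$ with $\omega(x,y,z)=1$ whenever one of $x,y,z$ equals the neutral element $e$, and $\omega(y,z,t)\omega(x,yz,t)\omega(x,y,z)=\omega(x,y,zt)\omega(xy,z,t)$ for all $x,y,z,t\in G$. A (normalized) $2$-cocycle on $G$ is a map $\varsigma:G\times G\to k^*$ with $\varsigma(e,x)=\varsigma(x,e)=1$ and $\varsigma(x,y)\varsigma(xy,z)=\varsigma(x,yz)\varsigma(y,z)$ for all $x,y,z\in G$ (trivial action). *)

theory Defs
  imports "HOL-Algebra.Ring"
begin

text \<open>
  Cochains on a group \<open>G\<close> are curried functions, and only their values on \<open>carrier G\<close>
  matter. The group \<open>k\<^sup>*\<close> is \<open>Units k\<close>, and a quotient \<open>a / b\<close> in it is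
  \<open>a \<otimes>\<^bsub>k\<^esub> inv\<^bsub>k\<^esub> b\<close>.
\<close>

definition normalized_3_cocycle ::
    "('a, 'm) monoid_scheme \<Rightarrow> ('b, 'n) ring_scheme \<Rightarrow> ('a \<Rightarrow> 'a \<Rightarrow> 'a \<Rightarrow> 'b) \<Rightarrow> bool"
  where "normalized_3_cocycle G k \<omega> \<longleftrightarrow>
    \<omega> \<in> carrier G \<rightarrow> carrier G \<rightarrow> carrier G \<rightarrow> Units k \<and>
    (\<forall>x \<in> carrier G. \<forall>y \<in> carrier G. \<forall>z \<in> carrier G.
      x = \<one>\<^bsub>G\<^esub> \<or> y = \<one>\<^bsub>G\<^esub> \<or> z = \<one>\<^bsub>G\<^esub> \<longrightarrow> \<omega> x y z = \<one>\<^bsub>k\<^esub>) \<and>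
    (\<forall>x \<in> carrier G. \<forall>y \<in> carrier G. \<forall>z \<in> carrier G. \<forall>t \<in> carrier G.
      \<omega> y z t \<otimes>\<^bsub>k\<^esub> \<omega> x (y \<otimes>\<^bsub>G\<^esub> z) t \<otimes>\<^bsub>k\<^esub> \<omega> x y z =
      \<omega> x y (z \<otimes>\<^bsub>G\<^esub> t) \<otimes>\<^bsub>k\<^esub> \<omega> (x \<otimes>\<^bsub>G\<^esub> y) z t)"

definition normalized_2_cocycle ::
    "('a, 'm) monoid_scheme \<Rightarrow> ('b, 'n) ring_scheme \<Rightarrow> ('a \<Rightarrow> 'a \<Rightarrow> 'b) \<Rightarrow> bool"
  where "normalized_2_cocycle G k \<sigma> \<longleftrightarrow>
    \<sigma> \<in> carrier G \<rightarrow> carrier G \<rightarrow> Units k \<and>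
    (\<forall>x \<in> carrier G. \<sigma> \<one>\<^bsub>G\<^esub> x = \<one>\<^bsub>k\<^esub> \<and> \<sigma> x \<one>\<^bsub>G\<^esub> = \<one>\<^bsub>k\<^esub>) \<and>
    (\<forall>x \<in> carrier G. \<forall>y \<in> carrier G. \<forall>z \<in> carrier G.
      \<sigma> x y \<otimes>\<^bsub>k\<^esub> \<sigma> (x \<otimes>\<^bsub>G\<^esub> y) z =
      \<sigma> x (y \<otimes>\<^bsub>G\<^esub> z) \<otimes>\<^bsub>k\<^esub> \<sigma> y z)"

definition flat_cochain ::
    "('b, 'n) ring_scheme \<Rightarrow> 'a \<Rightarrow> ('a \<Rightarrow> 'a \<Rightarrow> 'a \<Rightarrow> 'b) \<Rightarrow> 'a \<Rightarrow> 'a \<Rightarrow> 'b"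
  where "flat_cochain k g \<omega> x y =
    (\<omega> g x y \<otimes>\<^bsub>k\<^esub> \<omega> x y g) \<otimes>\<^bsub>k\<^esub> inv\<^bsub>k\<^esub> (\<omega> x g y)"

definition group_center :: "('a, 'm) monoid_scheme \<Rightarrow> 'a set"
  where "group_center G =
    {z \<in> carrier G. \<forall>x \<in> carrier G. z \<otimes>\<^bsub>G\<^esub> x = x \<otimes>\<^bsub>G\<^esub> z}"

end

theory Submission
  imports Defs
begin

text \<open>
  Put the extra letter \<open>g\<close> into each of the four possible positions of the word \<open>x y z\<close> and
  write down the 3-cocycle identity for the resulting quadruples \<open>(g, x, y, z)\<close>,
  \<open>(x, g, y, z)\<close>, \<open>(x, y, g, z)\<close> and \<open>(x, y, z, g)\<close>. In the alternating product of these four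
  identities the factor \<open>\<omega> x y z\<close>, which comes from the two outer positions, cancels. Among the
  remaining factors, those with an isolated entry \<open>g\<close> assemble into the coboundary

    \<open>flat x y \<cdot> flat (xy) z / (flat x (yz) \<cdot> flat y z)\<close>,

  and those in which \<open>g\<close> is multiplied onto one of the letters assemble into the quotient of
  the two sides \<open>L\<close>, \<open>R\<close> of the stated condition on \<open>\<omega>\<close>. So the coboundary equals \<open>L / R\<close>
  (lemma \<open>flat_cochain_coboundary\<close>), and one is trivial exactly when the other is.
  The values and normalization conditions of a 2-cocycle hold for every \<open>g\<close>
  (lemmas \<open>flat_cochain_Units\<close> and \<open>flat_cochain_normalized\<close>), and for central \<open>g\<close> the two
  sides \<open>L\<close> and \<open>R\<close> agree factor by factor.
\<close>

lemma (in comm_monoid) Units_fraction_mult: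
  assumes "a \<in> carrier G" "b \<in> carrier G" "c \<in> Units G" "d \<in> Units G"
  shows "(a \<otimes> inv c) \<otimes> (b \<otimes> inv d) \<otimes> (c \<otimes> d) = a \<otimes> b"
proof -
  have car: "c \<in> carrier G" "d \<in> carrier G" "inv c \<in> carrier G" "inv d \<in> carrier G"
    using assms by auto
  have "(a \<otimes> inv c) \<otimes> (b \<otimes> inv d) \<otimes> (c \<otimes> d)
      = (a \<otimes> b) \<otimes> ((inv c \<otimes> c) \<otimes> (inv d \<otimes> d))"
    using assms(1,2) car by (simp only: m_ac m_closed)
  then show ?thesis
    using assms by simp
qed

text \<open>
  The combinatorics of four cocycle identities \<open>A\<close>, \<open>B\<close>, \<open>C\<close>, \<open>D\<close>: \<open>A\<close> and \<open>C\<close> are read from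
  left to right, \<open>B\<close> and \<open>D\<close> from right to left, and the factor \<open>w\<close> shared by the outer two is
  cancelled. The variables \<open>a\<close> to \<open>d''\<close> stand for the values with an isolated entry \<open>g\<close>, while
  \<open>r\<close>, \<open>s\<close>, \<open>t\<close> and \<open>s'\<close>, \<open>t'\<close>, \<open>v\<close> are those in which \<open>g\<close> is multiplied onto a letter from the
  left and from the right.
\<close>

lemma (in comm_monoid) Units_alternating_product:
  assumes units: "w \<in> Units G"
    and car: "a \<in> carrier G" "a' \<in> carrier G" "a'' \<in> carrier G" "r \<in> carrier G"
      "b \<in> carrier G" "b' \<in> carrier G" "b'' \<in> carrier G" "s \<in> carrier G" "s' \<in> carrier G"
      "c \<in> carrier G" "c' \<in> carrier G" "c'' \<in> carrier G" "t \<in> carrier G" "t' \<in> carrier G"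
      "d \<in> carrier G" "d' \<in> carrier G" "d'' \<in> carrier G" "v \<in> carrier G"
    and A: "w \<otimes> a \<otimes> a' = a'' \<otimes> r"
    and B: "b \<otimes> s \<otimes> b' = b'' \<otimes> s'"
    and C: "c \<otimes> t' \<otimes> c' = t \<otimes> c''"
    and D: "d \<otimes> d' \<otimes> w = v \<otimes> d''"
  shows "(a \<otimes> a' \<otimes> b'' \<otimes> c \<otimes> c' \<otimes> d'') \<otimes> (s' \<otimes> t' \<otimes> v)
       = (a'' \<otimes> b \<otimes> b' \<otimes> c'' \<otimes> d \<otimes> d') \<otimes> (r \<otimes> s \<otimes> t)"
proof -
  have w: "w \<in> carrier G" using units by (rule Units_closed)
  have "w \<otimes> ((a \<otimes> a' \<otimes> b'' \<otimes> c \<otimes> c' \<otimes> d'') \<otimes> (s' \<otimes> t' \<otimes> v))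
      = (w \<otimes> a \<otimes> a') \<otimes> (b'' \<otimes> s') \<otimes> (c \<otimes> t' \<otimes> c') \<otimes> (v \<otimes> d'')"
    using car w by (simp only: m_ac m_closed)
  also have "\<dots> = (a'' \<otimes> r) \<otimes> (b \<otimes> s \<otimes> b') \<otimes> (t \<otimes> c'') \<otimes> (d \<otimes> d' \<otimes> w)"
    by (simp only: A B C D)
  also have "\<dots> = w \<otimes> ((a'' \<otimes> b \<otimes> b' \<otimes> c'' \<otimes> d \<otimes> d') \<otimes> (r \<otimes> s \<otimes> t))"
    using car w by (simp only: m_ac m_closed)
  finally show ?thesis
    using units car by simp
qed

text \<open>Here \<open>eq\<close> is \<open>p / q = l / r\<close> without quotients, so one side is \<open>\<one>\<close> iff the other is.\<close>

lemma (in comm_monoid) Units_cross_eq_iff: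
  assumes "p \<in> Units G" "q \<in> Units G" "l \<in> Units G" "r \<in> Units G"
    and eq: "p \<otimes> r = q \<otimes> l"
  shows "p = q \<longleftrightarrow> l = r"
proof
  assume "p = q"
  with assms show "l = r"
    by (metis Units_closed Units_l_cancel)
next
  assume "l = r"
  with assms have "r \<otimes> p = r \<otimes> q"
    by (simp add: m_comm Units_closed)
  with assms show "p = q"
    by (simp add: Units_closed)
qed

lemma (in comm_monoid) Units_clear_denominators:
  assumes units: "m \<in> Units G" "n \<in> Units G"
    and car: "P \<in> carrier G" "Q \<in> carrier G" "L \<in> carrier G" "R \<in> carrier G"
    and P: "P \<otimes> m = p" and Q: "Q \<otimes> n = q"
    and eq: "(p \<otimes> n) \<otimes> R = (q \<otimes> m) \<otimes> L"
  shows "P \<otimes> R = Q \<otimes> L"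
proof -
  have mn: "m \<in> carrier G" "n \<in> carrier G"
    using units by (auto intro: Units_closed)
  have "(m \<otimes> n) \<otimes> (P \<otimes> R) = (P \<otimes> m \<otimes> n) \<otimes> R"
    using car mn by (simp only: m_ac m_closed)
  also have "\<dots> = (Q \<otimes> n \<otimes> m) \<otimes> L"
    using eq by (simp only: P Q)
  also have "\<dots> = (m \<otimes> n) \<otimes> (Q \<otimes> L)"
    using car mn by (simp only: m_ac m_closed)
  finally show ?thesis
    using units car by (simp only: Units_l_cancel Units_m_closed m_closed)
qed

lemma normalized_3_cocycleD:
  assumes "normalized_3_cocycle G k \<omega>"
  shows normalized_3_cocycle_Units:
      "\<And>x y z. \<lbrakk>x \<in> carrier G; y \<in> carrier G; z \<in> carrier G\<rbrakk> \<Longrightarrow> \<omega> x y z \<in> Units k"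
    and normalized_3_cocycle_one:
      "\<And>x y z. \<lbrakk>x \<in> carrier G; y \<in> carrier G; z \<in> carrier G;
        x = \<one>\<^bsub>G\<^esub> \<or> y = \<one>\<^bsub>G\<^esub> \<or> z = \<one>\<^bsub>G\<^esub>\<rbrakk> \<Longrightarrow> \<omega> x y z = \<one>\<^bsub>k\<^esub>"
    and normalized_3_cocycle_identity:
      "\<And>x y z t. \<lbrakk>x \<in> carrier G; y \<in> carrier G; z \<in> carrier G; t \<in> carrier G\<rbrakk> \<Longrightarrow>
        \<omega> y z t \<otimes>\<^bsub>k\<^esub> \<omega> x (y \<otimes>\<^bsub>G\<^esub> z) t \<otimes>\<^bsub>k\<^esub> \<omega> x y z =
        \<omega> x y (z \<otimes>\<^bsub>G\<^esub> t) \<otimes>\<^bsub>k\<^esub> \<omega> (x \<otimes>\<^bsub>G\<^esub> y) z t"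
  using assms unfolding normalized_3_cocycle_def by (auto simp: Pi_iff)

lemma flat_cochain_Units:
  assumes "cring k" "normalized_3_cocycle G k \<omega>"
    and "g \<in> carrier G" "x \<in> carrier G" "y \<in> carrier G"
  shows "flat_cochain k g \<omega> x y \<in> Units k"
proof -
  interpret cring k by fact
  show ?thesis
    using assms(3-) unfolding flat_cochain_def
    by (intro Units_m_closed Units_inv_Units normalized_3_cocycle_Units[OF assms(2)])
qed

lemma flat_cochain_normalized:
  assumes "cring k" "monoid G" "normalized_3_cocycle G k \<omega>"
    and "g \<in> carrier G" "x \<in> carrier G"
  shows "flat_cochain k g \<omega> \<one>\<^bsub>G\<^esub> x = \<one>\<^bsub>k\<^esub>" "flat_cochain k g \<omega> x \<one>\<^bsub>G\<^esub> = \<one>\<^bsub>k\<^esub>"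
proof -
  interpret cring k by fact
  interpret G: monoid G by fact
  show "flat_cochain k g \<omega> \<one>\<^bsub>G\<^esub> x = \<one>\<^bsub>k\<^esub>" "flat_cochain k g \<omega> x \<one>\<^bsub>G\<^esub> = \<one>\<^bsub>k\<^esub>"
    using assms(4-) by (simp_all add: flat_cochain_def normalized_3_cocycle_one[OF assms(3)])
qed

text \<open>
  The identity \<open>P / Q = L / R\<close> between the coboundary of the flattened cochain and the defect
  of the condition on \<open>\<omega>\<close>. Clearing the denominators of the four values of \<open>flat_cochain\<close>
  leaves twelve values of \<open>\<omega>\<close>, three from each of the four cocycle identities.
\<close>

lemma flat_cochain_coboundary:
  assumes "cring k" "monoid G" "normalized_3_cocycle G k \<omega>"
    and g: "g \<in> carrier G" and x: "x \<in> carrier G" and y: "y \<in> carrier G" and z: "z \<in> carrier G"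
  shows "flat_cochain k g \<omega> x y \<otimes>\<^bsub>k\<^esub> flat_cochain k g \<omega> (x \<otimes>\<^bsub>G\<^esub> y) z \<otimes>\<^bsub>k\<^esub>
      (\<omega> (x \<otimes>\<^bsub>G\<^esub> g) y z \<otimes>\<^bsub>k\<^esub> \<omega> x (y \<otimes>\<^bsub>G\<^esub> g) z \<otimes>\<^bsub>k\<^esub> \<omega> x y (z \<otimes>\<^bsub>G\<^esub> g))
    = flat_cochain k g \<omega> x (y \<otimes>\<^bsub>G\<^esub> z) \<otimes>\<^bsub>k\<^esub> flat_cochain k g \<omega> y z \<otimes>\<^bsub>k\<^esub>
      (\<omega> (g \<otimes>\<^bsub>G\<^esub> x) y z \<otimes>\<^bsub>k\<^esub> \<omega> x (g \<otimes>\<^bsub>G\<^esub> y) z \<otimes>\<^bsub>k\<^esub> \<omega> x y (g \<otimes>\<^bsub>G\<^esub> z))"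
    (is "?P \<otimes>\<^bsub>k\<^esub> ?R = ?Q \<otimes>\<^bsub>k\<^esub> ?L")
proof -
  interpret cring k by fact
  interpret G: monoid G by fact
  note U = normalized_3_cocycle_Units[OF assms(3)]
  note W = Units_closed[OF U]
  note cocycle = normalized_3_cocycle_identity[OF assms(3)]
  note mem = g x y z G.m_closed
  let ?p = "(\<omega> g x y \<otimes>\<^bsub>k\<^esub> \<omega> x y g) \<otimes>\<^bsub>k\<^esub> (\<omega> g (x \<otimes>\<^bsub>G\<^esub> y) z \<otimes>\<^bsub>k\<^esub> \<omega> (x \<otimes>\<^bsub>G\<^esub> y) z g)"
  let ?q = "(\<omega> g x (y \<otimes>\<^bsub>G\<^esub> z) \<otimes>\<^bsub>k\<^esub> \<omega> x (y \<otimes>\<^bsub>G\<^esub> z) g) \<otimes>\<^bsub>k\<^esub> (\<omega> g y z \<otimes>\<^bsub>k\<^esub> \<omega> y z g)"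
  let ?m = "\<omega> x g y \<otimes>\<^bsub>k\<^esub> \<omega> (x \<otimes>\<^bsub>G\<^esub> y) g z"
  let ?n = "\<omega> x g (y \<otimes>\<^bsub>G\<^esub> z) \<otimes>\<^bsub>k\<^esub> \<omega> y g z"
  have units: "?m \<in> Units k" "?n \<in> Units k"
    by (intro Units_m_closed U mem)+
  have car: "?P \<in> carrier k" "?Q \<in> carrier k" "?L \<in> carrier k" "?R \<in> carrier k"
    by (intro m_closed W mem Units_closed[OF flat_cochain_Units[OF assms(1,3)]])+
  have P: "?P \<otimes>\<^bsub>k\<^esub> ?m = ?p"
    unfolding flat_cochain_def by (rule Units_fraction_mult) (intro m_closed U W mem)+
  have Q: "?Q \<otimes>\<^bsub>k\<^esub> ?n = ?q"
    unfolding flat_cochain_def by (rule Units_fraction_mult) (intro m_closed U W mem)+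
  \<comment> \<open>The four identities are those of \<open>g\<close> inserted before \<open>x\<close>, \<open>y\<close>, \<open>z\<close> and at the end.\<close>
  have key:
    "(\<omega> g (x \<otimes>\<^bsub>G\<^esub> y) z \<otimes>\<^bsub>k\<^esub> \<omega> g x y \<otimes>\<^bsub>k\<^esub> \<omega> x g (y \<otimes>\<^bsub>G\<^esub> z) \<otimes>\<^bsub>k\<^esub>
        \<omega> y g z \<otimes>\<^bsub>k\<^esub> \<omega> x y g \<otimes>\<^bsub>k\<^esub> \<omega> (x \<otimes>\<^bsub>G\<^esub> y) z g) \<otimes>\<^bsub>k\<^esub> ?R
    = (\<omega> g x (y \<otimes>\<^bsub>G\<^esub> z) \<otimes>\<^bsub>k\<^esub> \<omega> g y z \<otimes>\<^bsub>k\<^esub> \<omega> x g y \<otimes>\<^bsub>k\<^esub>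
        \<omega> (x \<otimes>\<^bsub>G\<^esub> y) g z \<otimes>\<^bsub>k\<^esub> \<omega> y z g \<otimes>\<^bsub>k\<^esub> \<omega> x (y \<otimes>\<^bsub>G\<^esub> z) g) \<otimes>\<^bsub>k\<^esub> ?L"
    by (rule Units_alternating_product[OF _ _ _ _ _ _ _ _ _ _ _ _ _ _ _ _ _ _ _
          cocycle[OF g x y z] cocycle[OF x g y z] cocycle[OF x y g z] cocycle[OF x y z g]])
      (intro U W mem)+
  have "(?p \<otimes>\<^bsub>k\<^esub> ?n) \<otimes>\<^bsub>k\<^esub> ?R
      = (\<omega> g (x \<otimes>\<^bsub>G\<^esub> y) z \<otimes>\<^bsub>k\<^esub> \<omega> g x y \<otimes>\<^bsub>k\<^esub> \<omega> x g (y \<otimes>\<^bsub>G\<^esub> z) \<otimes>\<^bsub>k\<^esub>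
        \<omega> y g z \<otimes>\<^bsub>k\<^esub> \<omega> x y g \<otimes>\<^bsub>k\<^esub> \<omega> (x \<otimes>\<^bsub>G\<^esub> y) z g) \<otimes>\<^bsub>k\<^esub> ?R"
    by (rule arg_cong[where f = "\<lambda>u. u \<otimes>\<^bsub>k\<^esub> ?R"]) (simp only: m_ac m_closed W mem)
  also note key
  also have "(\<omega> g x (y \<otimes>\<^bsub>G\<^esub> z) \<otimes>\<^bsub>k\<^esub> \<omega> g y z \<otimes>\<^bsub>k\<^esub> \<omega> x g y \<otimes>\<^bsub>k\<^esub>
        \<omega> (x \<otimes>\<^bsub>G\<^esub> y) g z \<otimes>\<^bsub>k\<^esub> \<omega> y z g \<otimes>\<^bsub>k\<^esub> \<omega> x (y \<otimes>\<^bsub>G\<^esub> z) g) \<otimes>\<^bsub>k\<^esub> ?L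
      = (?q \<otimes>\<^bsub>k\<^esub> ?m) \<otimes>\<^bsub>k\<^esub> ?L"
    by (rule arg_cong[where f = "\<lambda>u. u \<otimes>\<^bsub>k\<^esub> ?L"]) (simp only: m_ac m_closed W mem)
  finally show ?thesis
    by (rule Units_clear_denominators[OF units car P Q])
qed

theorem lemma4p1:
  fixes k :: "('b, 'n) ring_scheme" and G :: "('a, 'm) monoid_scheme"
    and \<omega> :: "'a \<Rightarrow> 'a \<Rightarrow> 'a \<Rightarrow> 'b" and g :: 'a
  assumes "field k"
    and "group G" and "finite (carrier G)"
    and "normalized_3_cocycle G k \<omega>"
    and "g \<in> carrier G"
  shows "(normalized_2_cocycle G k (flat_cochain k g \<omega>) \<longleftrightarrow>
      (\<forall>x \<in> carrier G. \<forall>y \<in> carrier G. \<forall>z \<in> carrier G.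
        \<omega> (g \<otimes>\<^bsub>G\<^esub> x) y z \<otimes>\<^bsub>k\<^esub> \<omega> x (g \<otimes>\<^bsub>G\<^esub> y) z \<otimes>\<^bsub>k\<^esub> \<omega> x y (g \<otimes>\<^bsub>G\<^esub> z) =
        \<omega> (x \<otimes>\<^bsub>G\<^esub> g) y z \<otimes>\<^bsub>k\<^esub> \<omega> x (y \<otimes>\<^bsub>G\<^esub> g) z \<otimes>\<^bsub>k\<^esub> \<omega> x y (z \<otimes>\<^bsub>G\<^esub> g))) \<and>
    (g \<in> group_center G \<longrightarrow> normalized_2_cocycle G k (flat_cochain k g \<omega>))"
    (is "(?cocycle \<longleftrightarrow> ?balanced) \<and> (_ \<longrightarrow> ?cocycle)")
proof -
  interpret field k by fact
  interpret G: group G by fact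
  note U = normalized_3_cocycle_Units[OF assms(4)]
  note flat_Units = flat_cochain_Units[OF is_cring assms(4,5)]
  note flat_one = flat_cochain_normalized[OF is_cring G.monoid_axioms assms(4,5)]
  have pointwise:
    "flat_cochain k g \<omega> x y \<otimes>\<^bsub>k\<^esub> flat_cochain k g \<omega> (x \<otimes>\<^bsub>G\<^esub> y) z =
      flat_cochain k g \<omega> x (y \<otimes>\<^bsub>G\<^esub> z) \<otimes>\<^bsub>k\<^esub> flat_cochain k g \<omega> y z \<longleftrightarrow>
      \<omega> (g \<otimes>\<^bsub>G\<^esub> x) y z \<otimes>\<^bsub>k\<^esub> \<omega> x (g \<otimes>\<^bsub>G\<^esub> y) z \<otimes>\<^bsub>k\<^esub> \<omega> x y (g \<otimes>\<^bsub>G\<^esub> z) =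
      \<omega> (x \<otimes>\<^bsub>G\<^esub> g) y z \<otimes>\<^bsub>k\<^esub> \<omega> x (y \<otimes>\<^bsub>G\<^esub> g) z \<otimes>\<^bsub>k\<^esub> \<omega> x y (z \<otimes>\<^bsub>G\<^esub> g)"
    if xyz: "x \<in> carrier G" "y \<in> carrier G" "z \<in> carrier G" for x y z
    by (rule Units_cross_eq_iff[OF _ _ _ _
          flat_cochain_coboundary[OF is_cring G.monoid_axioms assms(4,5) xyz]])
      (intro Units_m_closed flat_Units U G.m_closed xyz assms(5))+
  have iff: "?cocycle \<longleftrightarrow> ?balanced"
    unfolding normalized_2_cocycle_def Pi_iff using flat_Units flat_one pointwise by simp
  have "?balanced" if "g \<in> group_center G"
    using that by (simp add: group_center_def)
  with iff show ?thesis
    by blast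
qed

end
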